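(* The axioms (A1)-(A3) are sound and complete with respect to the class of induced non-standard probability functions of probabilistic models. That is: a function $p:\mathcal{L}\to\mathbb{R}$ satisfies (A1)-(A3) if and only if there is a probabilistic model $\mathcal{M}=\langle\Sigma,\mu,v^+,v^-\rangle$ whose induced non-standard probability function $p_\mu$ equals $p$.
   Context: Let $\mathrm{Prop}$ be a fixed finite set of propositional variables and let $\mathcal{L}$ be the set of formulas generated by $\varphi::= p\mid\neg\varphi\mid\varphi\wedge\varphi$ with $p\in\mathrm{Prop}$; $\varphi\vee\psi$ abbreviates $\neg(\neg\varphi\wedge\neg\psi)$. Belnap-Dunn entailment: a double valuation is a pair of functions $v^+,v^-:\mathrm{Prop}\to\{0,1\}$ (arbitrary and independent of each other), extended to $\mathcal{L}$ by: $v^+(\neg\varphi)=1$ iff $v^-(\varphi)=1$; $v^-(\neg\varphi)=1$ iff $v^+(\varphi)=1$; $v^+(\varphi\wedge\psi)=1$ iff $v^+(\varphi)=1$ and $v^+(\psi)=1$; $v^-(\varphi\wedge\psi)=1$ iff $v^-(\varphi)=1$ or $v^-(\psi)=1$. Write $\varphi\vDash_L\psi$ iff for all double valuations, $v^+(\varphi)=1$ implies $v^+(\psi)=1$. Axioms, for all $\varphi,\psi\in\mathcal{L}$: (A1) $0\le p(\varphi)\le 1$; (A2) if $\varphi\vDash_L\psi$ then $p(\varphi)\le p(\psi)$; (A3) $p(\varphi\wedge\psi)+p(\varphi\vee\psi)=p(\varphi)+p(\psi)$. A probabilistic model is a tuple $\langle\Sigma,\mu,v^+,v^-\rangle$ where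 $\Sigma$ is a finite or countably infinite set, $v^+,v^-:\Sigma\times\mathrm{Prop}\to\{0,1\}$ are arbitrary functions, and $\mu$ is a (classical) probability measure on the full power set of $\Sigma$. Relations $\models^+,\models^-$ between states $s\in\Sigma$ and formulas: $s\models^+p$ iff $v^+(s,p)=1$; $s\models^-p$ iff $v^-(s,p)=1$; $s\models^+\varphi\wedge\psi$ iff $s\models^+\varphi$ and $s\models^+\psi$; $s\models^-\varphi\wedge\psi$ iff $s\models^-\varphi$ or $s\models^-\psi$; $s\models^+\neg\varphi$ iff $s\models^-\varphi$; $s\models^-\neg\varphi$ iff $s\models^+\varphi$. The induced non-standard probability function is $p_\mu(\varphi)=\mu(\{s\in\Sigma: s\models^+\varphi\})$. *)

theory Defs
  imports "HOL-Probability.Probability"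
begin

datatype (atoms: 'v) form = Atom 'v | Neg "'v form" | Conj "'v form" "'v form"

definition Disj :: "'v form \<Rightarrow> 'v form \<Rightarrow> 'v form" where
  "Disj \<phi> \<psi> = Neg (Conj (Neg \<phi>) (Neg \<psi>))"

definition lang :: "'v set \<Rightarrow> 'v form set" where
  "lang P = {\<phi>. atoms \<phi> \<subseteq> P}"

text \<open>Truth values 0, 1 are rendered as booleans. A double valuation is a pair \<open>vp\<close>, \<open>vn\<close> of
  total functions on \<open>'v\<close>; on formulas of \<open>lang P\<close> only their values on \<open>P\<close> matter.\<close>

fun holds_pos :: "('v \<Rightarrow> bool) \<Rightarrow> ('v \<Rightarrow> bool) \<Rightarrow> 'v form \<Rightarrow> bool"
and holds_neg :: "('v \<Rightarrow> bool) \<Rightarrow> ('v \<Rightarrow> bool) \<Rightarrow> 'v form \<Rightarrow> bool" where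
  "holds_pos vp vn (Atom a) \<longleftrightarrow> vp a"
| "holds_pos vp vn (Neg \<phi>) \<longleftrightarrow> holds_neg vp vn \<phi>"
| "holds_pos vp vn (Conj \<phi> \<psi>) \<longleftrightarrow> holds_pos vp vn \<phi> \<and> holds_pos vp vn \<psi>"
| "holds_neg vp vn (Atom a) \<longleftrightarrow> vn a"
| "holds_neg vp vn (Neg \<phi>) \<longleftrightarrow> holds_pos vp vn \<phi>"
| "holds_neg vp vn (Conj \<phi> \<psi>) \<longleftrightarrow> holds_neg vp vn \<phi> \<or> holds_neg vp vn \<psi>"

definition bd_entails :: "'v form \<Rightarrow> 'v form \<Rightarrow> bool" where
  "bd_entails \<phi> \<psi> \<longleftrightarrow> (\<forall>vp vn. holds_pos vp vn \<phi> \<longrightarrow> holds_pos vp vn \<psi>)"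

text \<open>The axioms (A1), (A2), (A3), in this order; \<open>p\<close> is only constrained on \<open>lang P\<close>.\<close>

definition nonstandard_prob :: "'v set \<Rightarrow> ('v form \<Rightarrow> real) \<Rightarrow> bool" where
  "nonstandard_prob P p \<longleftrightarrow>
     (\<forall>\<phi>\<in>lang P. 0 \<le> p \<phi> \<and> p \<phi> \<le> 1) \<and>
     (\<forall>\<phi>\<in>lang P. \<forall>\<psi>\<in>lang P. bd_entails \<phi> \<psi> \<longrightarrow> p \<phi> \<le> p \<psi>) \<and>
     (\<forall>\<phi>\<in>lang P. \<forall>\<psi>\<in>lang P. p (Conj \<phi> \<psi>) + p (Disj \<phi> \<psi>) = p \<phi> + p \<psi>)"

record ('s, 'v) model =
  states :: "'s set"
  prob_meas :: "'s measure"
  val_pos :: "'s \<Rightarrow> 'v \<Rightarrow> bool"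
  val_neg :: "'s \<Rightarrow> 'v \<Rightarrow> bool"

text \<open>In the library, \<open>countable\<close> means finite or countably infinite.\<close>

definition probabilistic_model :: "('s, 'v) model \<Rightarrow> bool" where
  "probabilistic_model M \<longleftrightarrow>
     countable (states M) \<and>
     prob_space (prob_meas M) \<and>
     space (prob_meas M) = states M \<and>
     sets (prob_meas M) = Pow (states M)"

definition supports :: "('s, 'v) model \<Rightarrow> 's \<Rightarrow> 'v form \<Rightarrow> bool" where
  "supports M s \<phi> \<longleftrightarrow> holds_pos (val_pos M s) (val_neg M s) \<phi>"

definition rejects :: "('s, 'v) model \<Rightarrow> 's \<Rightarrow> 'v form \<Rightarrow> bool" where
  "rejects M s \<phi> \<longleftrightarrow> holds_neg (val_pos M s) (val_neg M s) \<phi>"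

lemma supports_simps [simp]:
  "supports M s (Atom a) \<longleftrightarrow> val_pos M s a"
  "supports M s (Conj \<phi> \<psi>) \<longleftrightarrow> supports M s \<phi> \<and> supports M s \<psi>"
  "supports M s (Neg \<phi>) \<longleftrightarrow> rejects M s \<phi>"
  by (simp_all add: supports_def rejects_def)

lemma rejects_simps [simp]:
  "rejects M s (Atom a) \<longleftrightarrow> val_neg M s a"
  "rejects M s (Conj \<phi> \<psi>) \<longleftrightarrow> rejects M s \<phi> \<or> rejects M s \<psi>"
  "rejects M s (Neg \<phi>) \<longleftrightarrow> supports M s \<phi>"
  by (simp_all add: supports_def rejects_def)

definition induced_prob :: "('s, 'v) model \<Rightarrow> 'v form \<Rightarrow> real" where
  "induced_prob M \<phi> = measure (prob_meas M) {s \<in> states M. supports M s \<phi>}"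

text \<open>Equality of \<open>p\<^sub>\<mu>\<close> and \<open>p\<close> as functions on the language over \<open>P\<close>.\<close>

definition induces :: "'v set \<Rightarrow> ('s, 'v) model \<Rightarrow> ('v form \<Rightarrow> real) \<Rightarrow> bool" where
  "induces P M p \<longleftrightarrow> (\<forall>\<phi>\<in>lang P. induced_prob M \<phi> = p \<phi>)"

end

theory Submission
  imports Defs
begin

text \<open>
  Soundness is the modularity and monotonicity of a measure, read through the truth clauses of
  \<open>\<and>\<close> and \<open>\<or>\<close>.

  For completeness, call a \<^emph>\<open>literal\<close> a variable with a sign, and identify a double valuation of
  the variables in \<open>P\<close> with the set of literals that it makes true. As the truth values of the two
  signs are independent, all subsets of \<open>P \<times> UNIV\<close> arise, and a formula becomes a family of such
  subsets, its truth set. Negation only switches between the two signs, so all connectives act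
  monotonically and truth sets are closed under supersets. They never contain the empty set and
  always contain the set of all literals. Conversely, every up-closed family with these two
  properties is a truth set, by disjunctive normal form (\<open>truth_set_surj\<close>). Since entailment is
  inclusion of truth sets, \<open>p\<close> is a monotone and modular function \<open>q\<close> on these families. It remains
  so when it is extended by 0 on the empty family and by 1 on the family of all sets of literals.

  It remains to see that a monotone modular \<open>q\<close> on the up-closed subsets of a finite poset,
  vanishing on the empty one, is a sum of non-negative point weights (\<open>modular_upsets_weights\<close>).
  A minimal element \<open>m\<close> of the poset \<open>X\<close> receives the weight \<open>q X - q (X - {m})\<close>, and modularity
  shows that adding \<open>m\<close> to any up-closed set increases \<open>q\<close> by the same amount, so that one may
  continue with \<open>X - {m}\<close>. The total weight is 1, and the weights form the probability
  measure of the desired model.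
\<close>

section \<open>Modular functions on the up-closed subsets of a finite poset\<close>

definition upset_of :: "'a::order set \<Rightarrow> 'a set \<Rightarrow> bool" where
  "upset_of X U \<longleftrightarrow> U \<subseteq> X \<and> (\<forall>x\<in>U. \<forall>y\<in>X. x \<le> y \<longrightarrow> y \<in> U)"

lemma upset_of_remove_minimal:
  assumes "\<And>x. x \<in> X \<Longrightarrow> x \<le> m \<Longrightarrow> x = m" and "upset_of (X - {m}) U"
  shows "upset_of X U"
  using assms unfolding upset_of_def by blast

lemma upset_of_Diff_minimal:
  assumes "\<And>x. x \<in> X \<Longrightarrow> x \<le> m \<Longrightarrow> x = m" and "upset_of X U"
  shows "upset_of (X - {m}) (U - {m})"
  using assms unfolding upset_of_def by blast

text \<open>Up-closed sets that avoid a minimal element \<open>m\<close> are the up-closed sets of \<open>X - {m}\<close>, which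
  drives an induction on the poset. An up-closed \<open>U\<close> that contains \<open>m\<close> satisfies
  \<open>U \<union> (X - {m}) = X\<close> and \<open>U \<inter> (X - {m}) = U - {m}\<close>, so modularity gives
  \<open>q U - q (U - {m}) = q X - q (X - {m})\<close>, independently of \<open>U\<close>.\<close>

lemma modular_upsets_weights:
  fixes q :: "'a::order set \<Rightarrow> real"
  assumes "finite X"
    and "q {} = 0"
    and "\<And>U V. upset_of X U \<Longrightarrow> upset_of X V \<Longrightarrow> U \<subseteq> V \<Longrightarrow> q U \<le> q V"
    and "\<And>U V. upset_of X U \<Longrightarrow> upset_of X V \<Longrightarrow> q (U \<inter> V) + q (U \<union> V) = q U + q V"
  shows "\<exists>w. (\<forall>x. 0 \<le> w x) \<and> (\<forall>U. upset_of X U \<longrightarrow> q U = sum w U)"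
  using assms
proof (induction "card X" arbitrary: X)
  case 0
  then show ?case
    by (intro exI[of _ "\<lambda>_. 0"]) (auto simp: upset_of_def)
next
  case (Suc n)
  then have "X \<noteq> {}" by auto
  then obtain m where m: "m \<in> X" and min: "\<And>x. x \<in> X \<Longrightarrow> x \<le> m \<Longrightarrow> x = m"
    using finite_has_minimal[OF \<open>finite X\<close>] by metis
  let ?Y = "X - {m}"
  have lift: "upset_of X U" if "upset_of ?Y U" for U
    using upset_of_remove_minimal[OF min that] .
  have "\<exists>w. (\<forall>x. 0 \<le> w x) \<and> (\<forall>U. upset_of ?Y U \<longrightarrow> q U = sum w U)"
    using Suc.hyps(2) Suc.prems(1,2) m by (intro Suc.hyps(1) Suc.prems(3,4) lift) auto
  then obtain w where w_nonneg: "\<And>x. 0 \<le> w x"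
    and w: "\<And>U. upset_of ?Y U \<Longrightarrow> q U = sum w U" by blast
  define w' where "w' = w(m := q X - q ?Y)"
  have X: "upset_of X X" and Y: "upset_of X ?Y"
    using lift[of ?Y] by (auto simp: upset_of_def)
  have "0 \<le> w' x" for x
    using w_nonneg Suc.prems(3)[OF Y X] by (auto simp: w'_def)
  moreover have "q U = sum w' U" if U: "upset_of X U" for U
  proof -
    have rest: "q (U - {m}) = sum w' (U - {m})"
      using w[OF upset_of_Diff_minimal[OF min U]] by (simp add: w'_def)
    show ?thesis
    proof (cases "m \<in> U")
      case False
      then show ?thesis using rest by simp
    next
      case True
      have "U \<subseteq> X" using U by (simp add: upset_of_def)
      then have "U \<inter> ?Y = U - {m}" "U \<union> ?Y = X" using True by auto
      then have "q (U - {m}) + q X = q U + q ?Y"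
        using Suc.prems(4)[OF U Y] by simp
      moreover have "finite U" using \<open>U \<subseteq> X\<close> Suc.prems(1) finite_subset by blast
      ultimately show ?thesis
        using rest True by (simp add: sum.remove w'_def)
    qed
  qed
  ultimately show ?case by blast
qed

section \<open>Truth sets of formulas\<close>

text \<open>A literal is a variable with the sign \<open>True\<close> for its positive and \<open>False\<close> for its negative
  valuation.\<close>

definition literals :: "'v set \<Rightarrow> ('v \<times> bool) set" where
  "literals P = P \<times> UNIV"

definition holds_at :: "('v \<times> bool) set \<Rightarrow> 'v form \<Rightarrow> bool" where
  "holds_at s \<phi> \<longleftrightarrow> holds_pos (\<lambda>a. (a, True) \<in> s) (\<lambda>a. (a, False) \<in> s) \<phi>"

definition truth_set :: "'v set \<Rightarrow> 'v form \<Rightarrow> ('v \<times> bool) set set" where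
  "truth_set P \<phi> = {s \<in> Pow (literals P). holds_at s \<phi>}"

lemma lang_simps [simp]:
  "Atom a \<in> lang P \<longleftrightarrow> a \<in> P"
  "Neg \<phi> \<in> lang P \<longleftrightarrow> \<phi> \<in> lang P"
  "Conj \<phi> \<psi> \<in> lang P \<longleftrightarrow> \<phi> \<in> lang P \<and> \<psi> \<in> lang P"
  "Disj \<phi> \<psi> \<in> lang P \<longleftrightarrow> \<phi> \<in> lang P \<and> \<psi> \<in> lang P"
  by (auto simp: lang_def Disj_def)

lemma holds_pos_Disj [simp]:
  "holds_pos vp vn (Disj \<phi> \<psi>) \<longleftrightarrow> holds_pos vp vn \<phi> \<or> holds_pos vp vn \<psi>"
  by (simp add: Disj_def)

lemma holds_at_simps [simp]:
  "holds_at s (Atom a) \<longleftrightarrow> (a, True) \<in> s"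
  "holds_at s (Neg (Atom a)) \<longleftrightarrow> (a, False) \<in> s"
  "holds_at s (Conj \<phi> \<psi>) \<longleftrightarrow> holds_at s \<phi> \<and> holds_at s \<psi>"
  "holds_at s (Disj \<phi> \<psi>) \<longleftrightarrow> holds_at s \<phi> \<or> holds_at s \<psi>"
  by (simp_all add: holds_at_def)

lemma truth_set_Conj: "truth_set P (Conj \<phi> \<psi>) = truth_set P \<phi> \<inter> truth_set P \<psi>"
  by (auto simp: truth_set_def)

lemma truth_set_Disj: "truth_set P (Disj \<phi> \<psi>) = truth_set P \<phi> \<union> truth_set P \<psi>"
  by (auto simp: truth_set_def)

lemma holds_cong_lang:
  assumes "\<phi> \<in> lang P" "\<And>a. a \<in> P \<Longrightarrow> vp a = vp' a" "\<And>a. a \<in> P \<Longrightarrow> vn a = vn' a"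
  shows "holds_pos vp vn \<phi> = holds_pos vp' vn' \<phi> \<and> holds_neg vp vn \<phi> = holds_neg vp' vn' \<phi>"
  using assms by (induction \<phi>) auto

lemma holds_mono:
  assumes "\<And>a. vp a \<Longrightarrow> vp' a" "\<And>a. vn a \<Longrightarrow> vn' a"
  shows "(holds_pos vp vn \<phi> \<longrightarrow> holds_pos vp' vn' \<phi>) \<and> (holds_neg vp vn \<phi> \<longrightarrow> holds_neg vp' vn' \<phi>)"
  using assms by (induction \<phi>) auto

text \<open>Where no literal is true, no formula is true or false.\<close>

lemma holds_none:
  "\<not> holds_pos (\<lambda>_. False) (\<lambda>_. False) \<phi> \<and> \<not> holds_neg (\<lambda>_. False) (\<lambda>_. False) \<phi>"
  by (induction \<phi>) auto

lemma holds_all: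
  "holds_pos (\<lambda>_. True) (\<lambda>_. True) \<phi> \<and> holds_neg (\<lambda>_. True) (\<lambda>_. True) \<phi>"
  by (induction \<phi>) auto

lemma empty_notin_truth_set: "{} \<notin> truth_set P \<phi>"
  by (simp add: truth_set_def holds_at_def holds_none)

lemma literals_in_truth_set:
  assumes "\<phi> \<in> lang P"
  shows "literals P \<in> truth_set P \<phi>"
  using holds_all[of \<phi>]
    holds_cong_lang[OF assms, of "\<lambda>_. True" "\<lambda>a. (a, True) \<in> literals P"
      "\<lambda>_. True" "\<lambda>a. (a, False) \<in> literals P"]
  by (simp add: truth_set_def holds_at_def literals_def)

lemma upset_of_truth_set: "upset_of (Pow (literals P)) (truth_set P \<phi>)"
proof -
  have "holds_at t \<phi>" if "holds_at s \<phi>" "s \<subseteq> t" for s t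
    using that holds_mono[of "\<lambda>a. (a, True) \<in> s" "\<lambda>a. (a, True) \<in> t"
      "\<lambda>a. (a, False) \<in> s" "\<lambda>a. (a, False) \<in> t" \<phi>]
    by (auto simp: holds_at_def)
  then show ?thesis by (auto simp: upset_of_def truth_set_def)
qed

text \<open>Cutting a double valuation down to the literals over \<open>P\<close> leaves the values of the formulas in
  \<open>lang P\<close> unchanged, so sets of literals are enough to test an entailment.\<close>

lemma bd_entails_if_truth_set_subset:
  assumes "\<phi> \<in> lang P" "\<psi> \<in> lang P" "truth_set P \<phi> \<subseteq> truth_set P \<psi>"
  shows "bd_entails \<phi> \<psi>"
  unfolding bd_entails_def
proof (intro allI impI)
  fix vp vn assume holds: "holds_pos vp vn \<phi>"
  define s where "s = {(a, b). a \<in> P \<and> (if b then vp a else vn a)}"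
  have agree: "holds_at s \<theta> \<longleftrightarrow> holds_pos vp vn \<theta>" if "\<theta> \<in> lang P" for \<theta>
    unfolding holds_at_def using that by (intro conjunct1[OF holds_cong_lang]) (auto simp: s_def)
  have "s \<in> truth_set P \<phi>"
    using holds agree[OF assms(1)] by (auto simp: truth_set_def s_def literals_def)
  then have "s \<in> truth_set P \<psi>" using assms(3) by blast
  then show "holds_pos vp vn \<psi>"
    using agree[OF assms(2)] by (simp add: truth_set_def)
qed

text \<open>The language has no constants for truth and falsity. Hence empty conjunctions and disjunctions
  are not available, and the empty set has to be excluded as a conjunction and as a family.\<close>

lemma ex_conjunction_of_literals:
  assumes "finite s" "s \<noteq> {}" "s \<subseteq> literals P"
  shows "\<exists>\<phi>\<in>lang P. \<forall>t. holds_at t \<phi> \<longleftrightarrow> s \<subseteq> t"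
proof -
  have lit: "\<exists>\<phi>\<in>lang P. \<forall>t. holds_at t \<phi> \<longleftrightarrow> l \<in> t" if "l \<in> literals P" for l
  proof (cases l)
    case (Pair a b)
    then show ?thesis
      using that by (intro bexI[of _ "if b then Atom a else Neg (Atom a)"]) (auto simp: literals_def)
  qed
  show ?thesis
    using assms
  proof (induction s rule: finite_ne_induct)
    case (singleton l)
    then show ?case using lit[of l] by auto
  next
    case (insert l s)
    then obtain \<phi> \<psi> where "\<phi> \<in> lang P" "\<forall>t. holds_at t \<phi> \<longleftrightarrow> l \<in> t"
        "\<psi> \<in> lang P" "\<forall>t. holds_at t \<psi> \<longleftrightarrow> s \<subseteq> t"
      using lit[of l] by auto
    then show ?case by (intro bexI[of _ "Conj \<phi> \<psi>"]) auto
  qed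
qed

lemma ex_disjunctive_normal_form:
  assumes "finite U" "U \<noteq> {}" "{} \<notin> U" "U \<subseteq> Pow (literals P)" "finite P"
  shows "\<exists>\<phi>\<in>lang P. \<forall>t. holds_at t \<phi> \<longleftrightarrow> (\<exists>s\<in>U. s \<subseteq> t)"
proof -
  have fin: "finite s" if "s \<subseteq> literals P" for s
    using finite_subset[OF that] \<open>finite P\<close> by (simp add: literals_def)
  show ?thesis
    using assms(1-4)
  proof (induction U rule: finite_ne_induct)
    case (singleton s)
    then show ?case using ex_conjunction_of_literals[of s P] fin by auto
  next
    case (insert s U)
    then obtain \<phi> \<psi> where "\<phi> \<in> lang P" "\<forall>t. holds_at t \<phi> \<longleftrightarrow> s \<subseteq> t"
        "\<psi> \<in> lang P" "\<forall>t. holds_at t \<psi> \<longleftrightarrow> (\<exists>s\<in>U. s \<subseteq> t)"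
      using ex_conjunction_of_literals[of s P] fin[of s] by auto
    then show ?case by (intro bexI[of _ "Disj \<phi> \<psi>"]) auto
  qed
qed

text \<open>An up-closed family consists of the supersets of its own members, so the disjunctive normal
  form over all its members describes it.\<close>

lemma truth_set_surj:
  assumes "finite P" "upset_of (Pow (literals P)) U" "U \<noteq> {}" "{} \<notin> U"
  shows "\<exists>\<phi>\<in>lang P. truth_set P \<phi> = U"
proof -
  have sub: "U \<subseteq> Pow (literals P)" using assms(2) by (simp add: upset_of_def)
  then have "finite U"
    by (rule finite_subset) (simp add: literals_def \<open>finite P\<close>)
  then obtain \<phi> where "\<phi> \<in> lang P" "\<forall>t. holds_at t \<phi> \<longleftrightarrow> (\<exists>s\<in>U. s \<subseteq> t)"
    using ex_disjunctive_normal_form[of U P] sub assms by auto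
  then show ?thesis
    using assms(2) by (intro bexI[of _ \<phi>]) (auto simp: upset_of_def truth_set_def)
qed

section \<open>Soundness\<close>

lemma induces_imp_nonstandard_prob:
  assumes "probabilistic_model M" "induces P M p"
  shows "nonstandard_prob P p"
proof -
  interpret prob_space "prob_meas M" using assms(1) by (simp add: probabilistic_model_def)
  define S where "S \<phi> = {s \<in> states M. supports M s \<phi>}" for \<phi>
  have p: "p \<phi> = prob (S \<phi>)" if "\<phi> \<in> lang P" for \<phi>
    using that assms(2) by (simp add: induces_def induced_prob_def S_def)
  have meas: "A \<in> events" if "A \<subseteq> states M" for A
    using that assms(1) by (simp add: probabilistic_model_def)
  have "p \<phi> \<le> p \<psi>" if "\<phi> \<in> lang P" "\<psi> \<in> lang P" "bd_entails \<phi> \<psi>" for \<phi> \<psi>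
    using that by (auto simp: p S_def supports_def bd_entails_def intro!: finite_measure_mono meas)
  moreover have "p (Conj \<phi> \<psi>) + p (Disj \<phi> \<psi>) = p \<phi> + p \<psi>"
    if "\<phi> \<in> lang P" "\<psi> \<in> lang P" for \<phi> \<psi>
  proof -
    have sets: "S (Conj \<phi> \<psi>) = S \<phi> \<inter> S \<psi>" "S (Disj \<phi> \<psi>) = S \<phi> \<union> S \<psi>"
      by (auto simp: S_def supports_def)
    have "prob (S \<phi> \<union> S \<psi>) = prob (S \<phi>) + prob (S \<psi> - S \<phi>)"
      by (intro finite_measure_Union') (auto simp: S_def intro: meas)
    moreover have "prob (S \<psi> - S \<phi>) = prob (S \<psi>) - prob (S \<phi> \<inter> S \<psi>)"
      by (subst finite_measure_Diff') (auto simp: S_def Int_commute intro: meas)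
    ultimately show ?thesis using that by (simp add: p sets)
  qed
  ultimately show ?thesis
    by (auto simp: nonstandard_prob_def p)
qed

section \<open>Completeness\<close>

text \<open>The function that \<open>p\<close> induces on truth sets, with the only possible values of a probability
  at the two up-closed families that are not truth sets.\<close>

definition upset_prob :: "'v set \<Rightarrow> ('v form \<Rightarrow> real) \<Rightarrow> ('v \<times> bool) set set \<Rightarrow> real" where
  "upset_prob P p U =
     (if U = {} then 0 else if {} \<in> U then 1 else p (SOME \<phi>. \<phi> \<in> lang P \<and> truth_set P \<phi> = U))"

lemma upset_prob_simps:
  "upset_prob P p {} = 0"
  "upset_prob P p (Pow S) = 1"
  by (auto simp: upset_prob_def)

text \<open>Formulas with equal truth sets entail each other, so monotonicity makes the choice of the
  formula irrelevant.\<close>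

lemma upset_prob_truth_set:
  assumes "nonstandard_prob P p" "\<phi> \<in> lang P"
  shows "upset_prob P p (truth_set P \<phi>) = p \<phi>"
proof -
  define \<psi> where "\<psi> = (SOME \<psi>. \<psi> \<in> lang P \<and> truth_set P \<psi> = truth_set P \<phi>)"
  have \<psi>: "\<psi> \<in> lang P \<and> truth_set P \<psi> = truth_set P \<phi>"
    unfolding \<psi>_def by (rule someI[of _ \<phi>]) (simp add: assms(2))
  then have "bd_entails \<phi> \<psi>" "bd_entails \<psi> \<phi>"
    using assms(2) by (auto intro: bd_entails_if_truth_set_subset)
  then have "p \<psi> = p \<phi>"
    using assms \<psi> by (auto simp: nonstandard_prob_def intro: antisym)
  moreover have "upset_prob P p (truth_set P \<phi>) = p \<psi>"
    using empty_notin_truth_set literals_in_truth_set[OF assms(2)]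
    unfolding upset_prob_def \<psi>_def by auto
  ultimately show ?thesis by simp
qed

lemma upset_cases:
  assumes "finite P" "upset_of (Pow (literals P)) U"
  obtains "U = {}" | "U = Pow (literals P)" | \<phi> where "\<phi> \<in> lang P" "U = truth_set P \<phi>"
proof (cases "{} \<in> U")
  case True
  then have "U = Pow (literals P)" using assms(2) by (auto simp: upset_of_def)
  then show thesis using that by blast
next
  case False
  then show thesis using truth_set_surj[OF assms] that by metis
qed

lemma upset_prob_mono:
  assumes "finite P" "nonstandard_prob P p"
    and U: "upset_of (Pow (literals P)) U" and V: "upset_of (Pow (literals P)) V" and "U \<subseteq> V"
  shows "upset_prob P p U \<le> upset_prob P p V"
proof -
  note range = assms(2)[unfolded nonstandard_prob_def, THEN conjunct1]
  show ?thesis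
  proof (cases rule: upset_cases[OF assms(1) U])
    case 1
    show ?thesis
      using range
      by (cases rule: upset_cases[OF assms(1) V])
        (simp_all add: 1 upset_prob_simps upset_prob_truth_set[OF assms(2)])
  next
    case 2
    then have "V = U" using \<open>U \<subseteq> V\<close> V by (auto simp: upset_of_def)
    then show ?thesis by simp
  next
    case (3 \<phi>)
    note \<phi> = 3
    show ?thesis
    proof (cases rule: upset_cases[OF assms(1) V])
      case 1
      then show ?thesis using \<open>U \<subseteq> V\<close> by simp
    next
      case 2
      then show ?thesis
        using range \<phi> by (simp add: upset_prob_simps upset_prob_truth_set[OF assms(2)])
    next
      case (3 \<psi>)
      then have "bd_entails \<phi> \<psi>"
        using \<phi> \<open>U \<subseteq> V\<close> by (auto intro: bd_entails_if_truth_set_subset)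
      then have "p \<phi> \<le> p \<psi>"
        using assms(2) \<phi> 3 by (simp add: nonstandard_prob_def)
      then show ?thesis using \<phi> 3 by (simp add: upset_prob_truth_set[OF assms(2)])
    qed
  qed
qed

lemma upset_prob_modular:
  assumes "finite P" "nonstandard_prob P p"
    and U: "upset_of (Pow (literals P)) U" and V: "upset_of (Pow (literals P)) V"
  shows "upset_prob P p (U \<inter> V) + upset_prob P p (U \<union> V) = upset_prob P p U + upset_prob P p V"
proof -
  \<comment> \<open>Modularity is trivial on comparable sets, which settles the two extreme families.\<close>
  have comparable: ?thesis if "U \<subseteq> V \<or> V \<subseteq> U"
    using that by (auto simp: Int_absorb1 Int_absorb2 Un_absorb1 Un_absorb2)
  have sub: "U \<subseteq> Pow (literals P)" "V \<subseteq> Pow (literals P)"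
    using U V by (auto simp: upset_of_def)
  show ?thesis
  proof (cases rule: upset_cases[OF assms(1) U])
    case (3 \<phi>)
    note \<phi> = 3
    show ?thesis
    proof (cases rule: upset_cases[OF assms(1) V])
      case (3 \<psi>)
      have "p (Conj \<phi> \<psi>) + p (Disj \<phi> \<psi>) = p \<phi> + p \<psi>"
        using assms(2) \<phi> 3 by (simp add: nonstandard_prob_def)
      then show ?thesis
        using assms(2) \<phi> 3
        by (simp add: upset_prob_truth_set flip: truth_set_Conj truth_set_Disj)
    qed (use comparable sub in auto)
  qed (use comparable sub in auto)
qed

text \<open>The sets of literals serve as states, each drawn with its weight and encoded as a natural
  number. The numbers that encode no set of literals are states of probability 0.\<close>

lemma nonstandard_prob_imp_induced:
  assumes "finite P" and p: "nonstandard_prob P p"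
  shows "\<exists>M :: (nat, 'v) model. probabilistic_model M \<and> induces P M p"
proof -
  let ?X = "Pow (literals P) :: ('v \<times> bool) set set"
  have fin: "finite ?X" using assms(1) by (simp add: literals_def)
  obtain w where w_nonneg: "\<And>x. 0 \<le> w x"
    and w: "\<And>U. upset_of ?X U \<Longrightarrow> upset_prob P p U = sum w U"
    using modular_upsets_weights[OF fin, of "upset_prob P p"]
      upset_prob_mono[OF assms] upset_prob_modular[OF assms]
    by (auto simp: upset_prob_simps)
  have "upset_of ?X ?X" by (simp add: upset_of_def)
  then have "sum w ?X = 1" using w[of ?X] by (simp add: upset_prob_simps)
  define W where "W = embed_pmf (\<lambda>s. if s \<in> ?X then w s else 0)"
  have pmf_W: "pmf W s = (if s \<in> ?X then w s else 0)" for s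
    unfolding W_def
  proof (rule pmf_embed_pmf)
    have "(\<integral>\<^sup>+ x. ennreal (if x \<in> ?X then w x else 0) \<partial>count_space UNIV)
        = (\<Sum>x\<in>?X. ennreal (w x))"
      using fin by (subst nn_integral_count_space'[of ?X]) (auto intro!: sum.cong)
    also have "\<dots> = 1"
      using \<open>sum w ?X = 1\<close> w_nonneg by simp
    finally show "(\<integral>\<^sup>+ x. ennreal (if x \<in> ?X then w x else 0) \<partial>count_space UNIV) = 1" .
  qed (use w_nonneg in auto)
  have support: "set_pmf W \<subseteq> ?X"
    using pmf_W by (auto simp: set_pmf_eq split: if_splits)
  define code where "code = to_nat_on ?X"
  define decode where "decode = from_nat_into ?X"
  have decode: "decode (code s) = s" if "s \<in> ?X" for s
    using that fin by (simp add: code_def decode_def countable_finite)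
  define M :: "(nat, 'v) model" where
    "M = \<lparr>states = UNIV, prob_meas = measure_pmf (map_pmf code W),
          val_pos = (\<lambda>n a. (a, True) \<in> decode n), val_neg = (\<lambda>n a. (a, False) \<in> decode n)\<rparr>"
  have "probabilistic_model M"
    by (simp add: probabilistic_model_def M_def prob_space_measure_pmf)
  moreover have "induces P M p"
    unfolding induces_def
  proof
    fix \<phi> assume \<phi>: "\<phi> \<in> lang P"
    have "induced_prob M \<phi> = measure W {s. holds_at (decode (code s)) \<phi>}"
      by (simp add: induced_prob_def M_def supports_def holds_at_def vimage_def)
    also have "\<dots> = measure W (truth_set P \<phi>)"
      using support decode
      by (intro measure_pmf.finite_measure_eq_AE AE_pmfI) (auto simp: truth_set_def subset_iff)
    also have "\<dots> = sum (pmf W) (truth_set P \<phi>)"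
      using fin by (intro measure_measure_pmf_finite) (simp add: truth_set_def)
    also have "\<dots> = sum w (truth_set P \<phi>)"
      by (intro sum.cong) (auto simp: pmf_W truth_set_def)
    also have "\<dots> = p \<phi>"
      using w[OF upset_of_truth_set] upset_prob_truth_set[OF p \<phi>] by metis
    finally show "induced_prob M \<phi> = p \<phi>" .
  qed
  ultimately show ?thesis by blast
qed

theorem corollary1:
  fixes P :: "'v set" and p :: "'v form \<Rightarrow> real"
  assumes "finite P"
  shows "(nonstandard_prob P p \<longleftrightarrow>
            (\<exists>M :: (nat, 'v) model. probabilistic_model M \<and> induces P M p)) \<and>
         (\<forall>M :: ('s, 'v) model. probabilistic_model M \<and> induces P M p \<longrightarrow> nonstandard_prob P p)"
proof (intro conjI iffI allI impI)
  show "\<exists>M :: (nat, 'v) model. probabilistic_model M \<and> induces P M p"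
    if "nonstandard_prob P p"
    using nonstandard_prob_imp_induced[OF assms that] .
qed (blast intro: induces_imp_nonstandard_prob)+

end
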